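(* (Catalan's identity) For $n,r\in\mathbb{N}$ such that $n\ge r$: 1. $M\mathbb{O}_{k,n+r}M\mathbb{O}_{k,n-r}-M\mathbb{O}_{k,n}^2=\dfrac{2^{n-r}\left[\alpha\beta(2^{r}-\lambda_1^{2r})+\beta\alpha(2^{r}-\lambda_2^{2r})\right]}{9k^2-8}$; 2. $M\mathbb{O}_{k,n-r}M\mathbb{O}_{k,n+r}-M\mathbb{O}_{k,n}^2=\dfrac{2^{n-r}\left[\alpha\beta(2^{r}-\lambda_2^{2r})+\beta\alpha(2^{r}-\lambda_1^{2r})\right]}{9k^2-8}$. Here $\alpha=\sum_{s=0}^{7}\lambda_1^{s}e_s$ and $\beta=\sum_{s=0}^{7}\lambda_2^{s}e_s$.
   Context: $\mathbb{N}$ is the set of positive integers. $\mathbb{O}$ denotes the octonions, the $8$-dimensional real (non-commutative, non-associative) algebra with basis $e_0=1,e_1,\dots,e_7$ and bilinear multiplication determined by: $e_0$ is the identity, $e_a^2=-1$ for $a\ge1$, $e_ae_b=-e_be_a$ for distinct $a,b\ge1$, and $e_ae_b=e_c$, $e_be_c=e_a$, $e_ce_a=e_b$ for $(a,b,c)\in\{(1,2,3),(1,4,5),(1,7,6),(2,4,6),(2,5,7),(3,4,7),(3,6,5)\}$. For a parameter $k$, the $k$-Mersenne numbers are defined by $M_{k,0}=0$, $M_{k,1}=1$, $M_{k,n+1}=3kM_{k,n}-2M_{k,n-1}$ for $n\ge1$. The $n$-th $k$-Mersenne octonion is $M\mathbb{O}_{k,n}=\sum_{s=0}^{7}M_{k,n+s}e_s$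 for $n\ge 0$. The numbers $\lambda_1=\frac{3k+\sqrt{9k^2-8}}{2}$ and $\lambda_2=\frac{3k-\sqrt{9k^2-8}}{2}$ are the roots of $\lambda^2-3k\lambda+2=0$. *)

theory Defs
  imports Complex_Main
begin

section \<open>The octonions\<close>

typedef octonion = "{x :: nat \<Rightarrow> real. \<forall>i>7. x i = 0}"
  morphisms octo_coeff Abs_octonion
  by (rule exI[of _ "\<lambda>_. 0"]) simp

setup_lifting type_definition_octonion

lemma octo_coeff_gt: "i > 7 \<Longrightarrow> octo_coeff x i = 0"
  using octo_coeff[of x] by simp

lemma octonion_eqI: "(\<And>i. i \<le> 7 \<Longrightarrow> octo_coeff x i = octo_coeff y i) \<Longrightarrow> x = y"
  by (metis octo_coeff_gt octo_coeff_inject ext not_le)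

definition octo_triples :: "(nat \<times> nat \<times> nat) set" where
  "octo_triples = {(1,2,3), (1,4,5), (1,7,6), (2,4,6), (2,5,7), (3,4,7), (3,6,5)}"

text \<open>\<open>octo_cyc a b c\<close> says that \<open>e\<^sub>a e\<^sub>b = e\<^sub>c\<close> holds because \<open>(a, b, c)\<close> is, up to cyclic
  rotation, one of the triples above.\<close>

definition octo_cyc :: "nat \<Rightarrow> nat \<Rightarrow> nat \<Rightarrow> bool" where
  "octo_cyc a b c \<longleftrightarrow>
     (a, b, c) \<in> octo_triples \<or> (b, c, a) \<in> octo_triples \<or> (c, a, b) \<in> octo_triples"

text \<open>\<open>octo_struct a b c\<close> is the coefficient of \<open>e\<^sub>c\<close> in the product \<open>e\<^sub>a e\<^sub>b\<close>,
  for \<open>a\<close>, \<open>b\<close>, \<open>c\<close> at most 7.\<close>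

definition octo_struct :: "nat \<Rightarrow> nat \<Rightarrow> nat \<Rightarrow> real" where
  "octo_struct a b c =
     (if a = 0 then (if c = b then 1 else 0)
      else if b = 0 then (if c = a then 1 else 0)
      else if a = b then (if c = 0 then - 1 else 0)
      else if octo_cyc a b c then 1
      else if octo_cyc b a c then - 1
      else 0)"

instantiation octonion :: real_vector
begin

lift_definition zero_octonion :: octonion is "\<lambda>_. 0" by simp
lift_definition plus_octonion :: "octonion \<Rightarrow> octonion \<Rightarrow> octonion" is "\<lambda>x y i. x i + y i" by simp
lift_definition minus_octonion :: "octonion \<Rightarrow> octonion \<Rightarrow> octonion" is "\<lambda>x y i. x i - y i" by simp
lift_definition uminus_octonion :: "octonion \<Rightarrow> octonion" is "\<lambda>x i. - x i" by simp
lift_definition scaleR_octonion :: "real \<Rightarrow> octonion \<Rightarrow> octonion" is "\<lambda>r x i. r * x i" by simp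

instance
  by standard (transfer; simp add: fun_eq_iff algebra_simps)+

end

lift_definition octo_e :: "nat \<Rightarrow> octonion" is "\<lambda>a i. if i = a \<and> i \<le> 7 then 1 else 0" by simp

text \<open>The octonions are not associative, so only the operations \<open>1\<close>, \<open>*\<close> and \<open>^\<close> are available,
  without the axioms of a monoid; \<open>x ^ 2\<close> unfolds to \<open>x * (x * 1)\<close>, which is \<open>x * x\<close>.\<close>

instantiation octonion :: power
begin

definition one_octonion :: octonion where "one_octonion = octo_e 0"

lift_definition times_octonion :: "octonion \<Rightarrow> octonion \<Rightarrow> octonion" is
  "\<lambda>x y c. if c \<le> 7 then \<Sum>a\<le>7. \<Sum>b\<le>7. x a * y b * octo_struct a b c else 0"
  by simp

instance ..

end

lemma octo_coeff_simps [simp]: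
  "octo_coeff 0 i = 0"
  "octo_coeff (x + y) i = octo_coeff x i + octo_coeff y i"
  "octo_coeff (x - y) i = octo_coeff x i - octo_coeff y i"
  "octo_coeff (- x) i = - octo_coeff x i"
  "octo_coeff (r *\<^sub>R x) i = r * octo_coeff x i"
  by (transfer; simp)+

lemma octo_coeff_e: "octo_coeff (octo_e a) i = (if i = a \<and> i \<le> 7 then 1 else 0)"
  by transfer simp

lemma octo_coeff_times:
  "c \<le> 7 \<Longrightarrow> octo_coeff (x * y) c =
     (\<Sum>a\<le>7. \<Sum>b\<le>7. octo_coeff x a * octo_coeff y b * octo_struct a b c)"
  by transfer simp

lemma octo_coeff_sum: "octo_coeff (\<Sum>j\<in>A. f j) i = (\<Sum>j\<in>A. octo_coeff (f j) i)"
  by (induction A rule: infinite_finite_induct) auto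

lemma octonion_expand: "x = (\<Sum>a\<le>7. octo_coeff x a *\<^sub>R octo_e a)"
  by (rule octonion_eqI)
     (simp add: octo_coeff_sum octo_coeff_e if_distrib[of "\<lambda>t. _ * t"] sum.delta cong: if_cong)

lemma octonion_bilinear:
  fixes x y z :: octonion
  shows "(x + y) * z = x * z + y * z"
    and "x * (y + z) = x * y + x * z"
    and "(r *\<^sub>R x) * y = r *\<^sub>R (x * y)"
    and "x * (r *\<^sub>R y) = r *\<^sub>R (x * y)"
  by (rule octonion_eqI;
      simp add: octo_coeff_times sum.distrib[symmetric] sum_distrib_left algebra_simps)+

lemma octo_coeff_e_times_e:
  assumes "a \<le> 7" "b \<le> 7" "c \<le> 7"
  shows "octo_coeff (octo_e a * octo_e b) c = octo_struct a b c"
proof -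
  have "octo_coeff (octo_e a * octo_e b) c =
      (\<Sum>i\<le>7. \<Sum>j\<le>7. if j = b then (if i = a then octo_struct i j c else 0) else 0)"
    unfolding octo_coeff_times[OF assms(3)]
    by (intro sum.cong refl) (auto simp: octo_coeff_e)
  also have "\<dots> = octo_struct a b c"
    using assms by simp
  finally show ?thesis .
qed

lemma octo_one_left: "1 * x = (x :: octonion)"
proof (rule octonion_eqI)
  fix c :: nat assume c: "c \<le> 7"
  have "octo_coeff (1 * x) c =
      (\<Sum>a\<le>(7::nat). if a = 0 then \<Sum>b\<le>(7::nat). if b = c then octo_coeff x b else 0 else 0)"
    unfolding octo_coeff_times[OF c]
    by (intro sum.cong refl)
       (auto simp: one_octonion_def octo_coeff_e octo_struct_def
         if_distrib[of "\<lambda>t. _ * t"] cong: if_cong)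
  then show "octo_coeff (1 * x) c = octo_coeff x c"
    using c by simp
qed

lemma octo_one_right: "x * 1 = (x :: octonion)"
proof (rule octonion_eqI)
  fix c :: nat assume c: "c \<le> 7"
  have "octo_coeff (x * 1) c =
      (\<Sum>a\<le>(7::nat). \<Sum>b\<le>(7::nat). if b = 0 then (if a = c then octo_coeff x a else 0) else 0)"
    unfolding octo_coeff_times[OF c]
    by (intro sum.cong refl)
       (auto simp: one_octonion_def octo_coeff_e octo_struct_def)
  then show "octo_coeff (x * 1) c = octo_coeff x c"
    using c by simp
qed

lemma octo_power2: "x ^ 2 = x * (x :: octonion)"
  by (simp add: numeral_2_eq_2 octo_one_right)

lemma octo_e_square: "1 \<le> a \<Longrightarrow> a \<le> 7 \<Longrightarrow> octo_e a * octo_e a = - 1"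
  by (rule octonion_eqI)
     (simp add: octo_coeff_e_times_e one_octonion_def octo_coeff_e octo_struct_def)

lemma octo_cyc_cases:
  "octo_cyc a b c \<longleftrightarrow> (a, b, c) \<in>
     {(1,2,3), (1,4,5), (1,7,6), (2,4,6), (2,5,7), (3,4,7), (3,6,5),
      (3,1,2), (5,1,4), (6,1,7), (6,2,4), (7,2,5), (7,3,4), (5,3,6),
      (2,3,1), (4,5,1), (7,6,1), (4,6,2), (5,7,2), (4,7,3), (6,5,3)}"
  unfolding octo_cyc_def octo_triples_def insert_iff empty_iff prod.inject by argo

lemma octo_cyc_props:
  assumes "octo_cyc a b c"
  shows "1 \<le> a \<and> a \<le> 7 \<and> 1 \<le> b \<and> b \<le> 7 \<and> a \<noteq> b"
    and "octo_cyc a b d \<longleftrightarrow> d = c"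
    and "\<not> octo_cyc b a d"
  using assms unfolding octo_cyc_cases insert_iff empty_iff prod.inject
  by (elim disjE conjE; simp)+

lemma octo_e_anticommute:
  assumes "1 \<le> a" "a \<le> 7" "1 \<le> b" "b \<le> 7" "a \<noteq> b"
  shows "octo_e a * octo_e b = - (octo_e b * octo_e a)"
proof (rule octonion_eqI)
  fix c :: nat assume "c \<le> 7"
  have "\<not> (octo_cyc a b c \<and> octo_cyc b a c)"
    using octo_cyc_props(3) by blast
  then show "octo_coeff (octo_e a * octo_e b) c = octo_coeff (- (octo_e b * octo_e a)) c"
    using assms \<open>c \<le> 7\<close> by (auto simp: octo_coeff_e_times_e octo_struct_def)
qed

lemma octo_e_triple:
  assumes "(a, b, c) \<in> octo_triples"
  shows "octo_e a * octo_e b = octo_e c"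
    and "octo_e b * octo_e c = octo_e a"
    and "octo_e c * octo_e a = octo_e b"
proof -
  have *: "octo_e a * octo_e b = octo_e c" if "octo_cyc a b c" for a b c
  proof (rule octonion_eqI)
    fix d :: nat assume d: "d \<le> 7"
    show "octo_coeff (octo_e a * octo_e b) d = octo_coeff (octo_e c) d"
      using d octo_cyc_props[OF that] by (simp add: octo_coeff_e_times_e octo_struct_def octo_coeff_e)
  qed
  show "octo_e a * octo_e b = octo_e c" "octo_e b * octo_e c = octo_e a"
    "octo_e c * octo_e a = octo_e b"
    using assms by (auto intro!: * simp: octo_cyc_def)
qed

section \<open>Mersenne octonions\<close>

fun k_mersenne :: "real \<Rightarrow> nat \<Rightarrow> real" where
  "k_mersenne k 0 = 0"
| "k_mersenne k (Suc 0) = 1"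
| "k_mersenne k (Suc (Suc n)) = 3 * k * k_mersenne k (Suc n) - 2 * k_mersenne k n"

definition mersenne_octonion :: "real \<Rightarrow> nat \<Rightarrow> octonion" where
  "mersenne_octonion k n = (\<Sum>s = 0..7. k_mersenne k (n + s) *\<^sub>R octo_e s)"

definition lambda1 :: "real \<Rightarrow> real" where
  "lambda1 k = (3 * k + sqrt (9 * k\<^sup>2 - 8)) / 2"

definition lambda2 :: "real \<Rightarrow> real" where
  "lambda2 k = (3 * k - sqrt (9 * k\<^sup>2 - 8)) / 2"

definition oct_alpha :: "real \<Rightarrow> octonion" where
  "oct_alpha k = (\<Sum>s = 0..7. lambda1 k ^ s *\<^sub>R octo_e s)"

definition oct_beta :: "real \<Rightarrow> octonion" where
  "oct_beta k = (\<Sum>s = 0..7. lambda2 k ^ s *\<^sub>R octo_e s)"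

end

theory Submission
  imports Defs
begin

text \<open>
  Catalan's identity follows from a Binet formula. Since \<open>\<lambda>\<^sub>1\<close> and \<open>\<lambda>\<^sub>2\<close> are the two roots of the
  characteristic polynomial of the recurrence, and their difference is \<open>\<surd>(9 k\<^sup>2 - 8)\<close>,
  \<open>\<surd>(9 k\<^sup>2 - 8) M\<^sub>n = \<lambda>\<^sub>1\<^sup>n - \<lambda>\<^sub>2\<^sup>n\<close>; collecting coordinates gives
  \<open>\<surd>(9 k\<^sup>2 - 8) MO\<^sub>n = \<lambda>\<^sub>1\<^sup>n \<alpha> - \<lambda>\<^sub>2\<^sup>n \<beta>\<close> (lemma \<open>mersenne_octonion_binet\<close>).

  In a product \<open>MO\<^sub>m MO\<^sub>q\<close> the coefficients of \<open>\<alpha>\<alpha>\<close> and \<open>\<beta>\<beta>\<close> depend on \<open>m + q\<close> only, so they cancel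
  when two products with the same index sum are subtracted, and a combination of \<open>\<alpha>\<beta>\<close> and \<open>\<beta>\<alpha>\<close>
  remains (lemma \<open>mersenne_octonion_products_diff\<close>). These two products stay apart because the
  octonions do not commute. The expansion rests on bilinearity alone, so it is valid without associativity.
  Both parts of the identity compare the indices \<open>n + r, n - r\<close>, in either order, with \<open>n, n\<close>, and
  \<open>\<lambda>\<^sub>1 \<lambda>\<^sub>2 = 2\<close> brings the coefficients into the stated form.
\<close>

lemma lambda_prod:
  assumes "9 * k\<^sup>2 - 8 \<ge> 0"
  shows "lambda1 k * lambda2 k = 2"
  using assms by (simp add: lambda1_def lambda2_def power2_eq_square field_simps)

lemma lambda_root:
  assumes "9 * k\<^sup>2 - 8 \<ge> 0" and "x \<in> {lambda1 k, lambda2 k}"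
  shows "x\<^sup>2 = 3 * k * x - 2"
proof -
  have "lambda1 k + lambda2 k = 3 * k"
    by (simp add: lambda1_def lambda2_def field_simps)
  then have "3 * k * x = (lambda1 k + lambda2 k) * x"
    by simp
  then show ?thesis
    using assms(2) lambda_prod[OF assms(1)] by (auto simp: power2_eq_square algebra_simps)
qed

lemma lambda_diff: "lambda1 k - lambda2 k = sqrt (9 * k\<^sup>2 - 8)"
  by (simp add: lambda1_def lambda2_def field_simps)

lemma k_mersenne_binet:
  assumes "9 * k\<^sup>2 - 8 \<ge> 0"
  shows "sqrt (9 * k\<^sup>2 - 8) * k_mersenne k n = lambda1 k ^ n - lambda2 k ^ n"
proof (induction n rule: induct_nat_012)
  case (ge2 n)
  have step: "x ^ Suc (Suc n) = 3 * k * x ^ Suc n - 2 * x ^ n"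
    if "x \<in> {lambda1 k, lambda2 k}" for x
  proof -
    have "x ^ Suc (Suc n) = x\<^sup>2 * x ^ n"
      by (simp add: power2_eq_square)
    then show ?thesis
      by (simp add: lambda_root[OF assms that] algebra_simps)
  qed
  have "sqrt (9 * k\<^sup>2 - 8) * k_mersenne k (Suc (Suc n)) =
      3 * k * (sqrt (9 * k\<^sup>2 - 8) * k_mersenne k (Suc n)) -
      2 * (sqrt (9 * k\<^sup>2 - 8) * k_mersenne k n)"
    by (simp add: algebra_simps)
  also have "\<dots> = 3 * k * (lambda1 k ^ Suc n - lambda2 k ^ Suc n) -
      2 * (lambda1 k ^ n - lambda2 k ^ n)"
    by (simp only: ge2)
  also have "\<dots> = lambda1 k ^ Suc (Suc n) - lambda2 k ^ Suc (Suc n)"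
    by (simp add: step algebra_simps del: power_Suc)
  finally show ?case .
qed (simp_all add: lambda_diff)

lemma octo_coeff_basis_combination:
  assumes "i \<le> 7"
  shows "octo_coeff (\<Sum>s = 0..7. f s *\<^sub>R octo_e s) i = f i"
  using assms
  by (simp add: octo_coeff_sum octo_coeff_e if_distrib[of "\<lambda>t. _ * t"] sum.delta cong: if_cong)

lemma mersenne_octonion_binet:
  assumes "9 * k\<^sup>2 - 8 \<ge> 0"
  shows "sqrt (9 * k\<^sup>2 - 8) *\<^sub>R mersenne_octonion k n =
    lambda1 k ^ n *\<^sub>R oct_alpha k - lambda2 k ^ n *\<^sub>R oct_beta k"
  by (rule octonion_eqI)
     (simp add: mersenne_octonion_def oct_alpha_def oct_beta_def octo_coeff_basis_combination
       k_mersenne_binet[OF assms] power_add)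

lemma octo_binomial_product:
  fixes x y :: octonion
  shows "(a *\<^sub>R x - b *\<^sub>R y) * (c *\<^sub>R x - d *\<^sub>R y) =
    (a * c) *\<^sub>R (x * x) + (b * d) *\<^sub>R (y * y) - (a * d) *\<^sub>R (x * y) - (b * c) *\<^sub>R (y * x)"
proof -
  have "(a *\<^sub>R x - b *\<^sub>R y) * (c *\<^sub>R x - d *\<^sub>R y) =
      (a *\<^sub>R x + (- b) *\<^sub>R y) * (c *\<^sub>R x + (- d) *\<^sub>R y)"
    by simp
  also have "\<dots> = (a * c) *\<^sub>R (x * x) + (b * d) *\<^sub>R (y * y)
      - (a * d) *\<^sub>R (x * y) - (b * c) *\<^sub>R (y * x)"
    unfolding octonion_bilinear by (simp add: algebra_simps)
  finally show ?thesis .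
qed

lemma mersenne_octonion_times:
  assumes "9 * k\<^sup>2 - 8 \<ge> 0"
  shows "(9 * k\<^sup>2 - 8) *\<^sub>R (mersenne_octonion k m * mersenne_octonion k q) =
    lambda1 k ^ (m + q) *\<^sub>R (oct_alpha k * oct_alpha k) +
    lambda2 k ^ (m + q) *\<^sub>R (oct_beta k * oct_beta k) -
    (lambda1 k ^ m * lambda2 k ^ q) *\<^sub>R (oct_alpha k * oct_beta k) -
    (lambda2 k ^ m * lambda1 k ^ q) *\<^sub>R (oct_beta k * oct_alpha k)"
proof -
  let ?D = "sqrt (9 * k\<^sup>2 - 8)"
  have "(9 * k\<^sup>2 - 8) *\<^sub>R (mersenne_octonion k m * mersenne_octonion k q) =
      (?D *\<^sub>R mersenne_octonion k m) * (?D *\<^sub>R mersenne_octonion k q)"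
    using assms by (simp add: octonion_bilinear)
  then show ?thesis
    by (simp add: mersenne_octonion_binet[OF assms] octo_binomial_product power_add)
qed

text \<open>The common index sum makes the \<open>\<alpha>\<alpha>\<close> and \<open>\<beta>\<beta>\<close> parts of the two products equal. This is a
  Vajda-type identity; Catalan's is the case \<open>m' = q'\<close>.\<close>

lemma mersenne_octonion_products_diff:
  assumes "9 * k\<^sup>2 - 8 > 0" and "m + q = m' + q'"
  shows "mersenne_octonion k m * mersenne_octonion k q -
      mersenne_octonion k m' * mersenne_octonion k q' =
    ((lambda1 k ^ m' * lambda2 k ^ q' - lambda1 k ^ m * lambda2 k ^ q) *\<^sub>R
        (oct_alpha k * oct_beta k) +
     (lambda2 k ^ m' * lambda1 k ^ q' - lambda2 k ^ m * lambda1 k ^ q) *\<^sub>R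
        (oct_beta k * oct_alpha k)) /\<^sub>R (9 * k\<^sup>2 - 8)"
    (is "?L = ?R /\<^sub>R ?d")
proof -
  have nonneg: "?d \<ge> 0"
    using assms(1) by simp
  have "?d *\<^sub>R ?L = ?R"
    unfolding scaleR_diff_right mersenne_octonion_times[OF nonneg] assms(2)
    by (simp add: scaleR_diff_left)
  then have "?R /\<^sub>R ?d = (inverse ?d * ?d) *\<^sub>R ?L"
    by (metis scaleR_scaleR)
  then show ?thesis
    using assms(1) by simp
qed

theorem theorem2p3:
  fixes k :: real and n r :: nat
  assumes "9 * k\<^sup>2 - 8 > 0"
    and "n \<ge> 1" and "r \<ge> 1" and "n \<ge> r"
  shows "mersenne_octonion k (n + r) * mersenne_octonion k (n - r) - (mersenne_octonion k n)\<^sup>2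
       = (2 ^ (n - r) *\<^sub>R
           ((2 ^ r - lambda1 k ^ (2 * r)) *\<^sub>R (oct_alpha k * oct_beta k)
          + (2 ^ r - lambda2 k ^ (2 * r)) *\<^sub>R (oct_beta k * oct_alpha k)))
         /\<^sub>R (9 * k\<^sup>2 - 8)
       \<and> mersenne_octonion k (n - r) * mersenne_octonion k (n + r) - (mersenne_octonion k n)\<^sup>2
       = (2 ^ (n - r) *\<^sub>R
           ((2 ^ r - lambda2 k ^ (2 * r)) *\<^sub>R (oct_alpha k * oct_beta k)
          + (2 ^ r - lambda1 k ^ (2 * r)) *\<^sub>R (oct_beta k * oct_alpha k)))
         /\<^sub>R (9 * k\<^sup>2 - 8)"
proof -
  let ?a = "lambda1 k" and ?b = "lambda2 k"
  obtain p where n: "n = p + r"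
    using assms(4) by (metis le_add_diff_inverse2)
  have ab: "?a * ?b = 2"
    using lambda_prod assms(1) by simp
  have pow: "?a ^ j * ?b ^ j = 2 ^ j" "?b ^ j * ?a ^ j = 2 ^ j" for j
    by (simp_all flip: power_mult_distrib add: ab mult.commute)
  \<comment> \<open>Since \<open>n + r = p + 2 r\<close>, a factor \<open>(\<lambda>\<^sub>1 \<lambda>\<^sub>2)\<^sup>p = 2\<^sup>p\<close> splits off and only \<open>2 r\<close> powers of one
    root are left.\<close>
  have shift: "?a ^ (n + r) * ?b ^ p = 2 ^ p * ?a ^ (2 * r)"
    "?b ^ (n + r) * ?a ^ p = 2 ^ p * ?b ^ (2 * r)"
    unfolding n pow(1)[of p, symmetric] by (simp_all add: power_add mult_2)
  note shift' = shift[unfolded mult.commute[of "_ ^ (n + r)"]]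
  have split: "(2::real) ^ n = 2 ^ p * 2 ^ r"
    by (simp add: n power_add)
  have "n - r = p"
    by (simp add: n)
  moreover have "n + r + p = n + n" "p + (n + r) = n + n"
    by (simp_all add: n)
  ultimately show ?thesis
    using assms(1)
    by (simp add: octo_power2 mersenne_octonion_products_diff pow shift shift' split
        scaleR_add_right flip: right_diff_distrib)
qed

end
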